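(* Let $f_t:M\hookrightarrow V$ ($0\le t<T$) be the regularized mean curvature flow starting from a $G$-invariant hypersurface immersion $f$ with $(\phi\circ f)(M)$ compact. Then the unit normal vector fields $\xi_t$ satisfy $$\frac{\partial\xi}{\partial t}=-F_*\big(\mathrm{grad}_g\|H\|\big),$$ where $\mathrm{grad}_g\|H\|$ is the section of $\pi_M^*(TM)$ with $d\|H\|(X)=g(\mathrm{grad}_g\|H\|,X)$ for all $X\in\pi_M^*(TM)$.
   Context: \textbf{Regularizable immersions.} $V$ is a separable infinite-dimensional Hilbert space with inner product $\langle\,,\rangle$. An immersion of a Hilbert manifold $M$ into $V$ is \emph{regularizable} if it has finite codimension, for every normal vector $v$ the shape operator $A_v$ is compact, and both $\mathrm{Tr}_r A_v:=\sum_{i=1}^\infty(\mu_i^++\mu_i^-)$ (where $\mu_1^-\le\mu_2^-\le\cdots\le0\le\cdots\le\mu_2^+\le\mu_1^+$ is the spectrum of $A_v$) and $\mathrm{Tr}\,A_v^2$ exist. Its \emph{regularized mean curvature vector} $H$ is the normal field with $\langle H,v\rangle=\mathrm{Tr}_rA_v$; it is \emph{minimal} if $H=0$. A family $f_t$ ($0\le t<T$) of regularizable immersions is a \emph{regularized mean curvature flow} if $\frac{\partial F}{\partial t}=H_t$, where $F(u,t)=f_t(u)$ and $H_t$ is the regularized mean curvature vector of $f_t$. \textbf{Setting.} $G$ is a Hilbert Lie group acting on $V$ isometrically and almost freely (finite stabilizers), all of whose orbits are minimal regularizable submanifolds; $\phi:V\to V/G$ is the orbit map onto the finite-dimensional orbifold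 $V/G$, with the Riemannian orbimetric making $\phi$ a Riemannian orbisubmersion. $f:M\hookrightarrow V$ is a $G$-invariant immersion of codimension one with $(\phi\circ f)(M)$ compact; the flow $f_t$ is the family obtained by moving each point $f(u)$ along the horizontal lift (orthogonal to the orbits, with initial velocity the regularized mean curvature vector of $f$ at $u$) of the trajectory of its projection under the mean curvature flow in $V/G$ of the hypersurface induced by $f$. \textbf{Notation.} $g_t$ is the metric induced by $f_t$ and $\xi_t$ the unit normal field with $H_t=\|H_t\|\xi_t$; $\|H\|=\sqrt{\langle H,H\rangle}$. $\pi_M:M\times[0,T)\to M$ is the projection and $\pi_M^*(TM)$ is regarded as a subbundle of $T(M\times[0,T))$; $g,H,\xi$ are the objects on $M\times[0,T)$ given by $g_t,H_t,\xi_t$ at time $t$. $H$ and $\xi$ are regarded as $V$-valued functions on $M\times[0,T)$, so that $\frac{\partial\xi}{\partial t}$ is an ordinary derivative. $F_*X=f_{t*}X$ for $X\in\pi_M^*(TM)_{(u,t)}=T_uM$. *)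

theory Defs
  imports "HOL-Analysis.Analysis" "HOL-Algebra.Group_Action"
begin

section \<open>Smooth maps between Hilbert spaces\<close>

text \<open>
  At each order only the directional values of the derivative are iterated, so for a single
  \<open>k\<close> this is weaker than Frechet \<open>C\<^sup>k\<close> in infinite dimensions.  For all \<open>k\<close>
  together it is Frechet smoothness: pointwise convergence of the derivatives gives local
  bounds in operator norm (uniform boundedness), hence norm continuity one order lower.
  The sets \<open>S\<close> used below are open, or products of \<open>[0,T)\<close> with an open set, so derivatives
  within \<open>S\<close> are unique (and one-sided in time at \<open>0\<close>).
\<close>

primrec Ck_on :: "nat \<Rightarrow> 'a::real_normed_vector set \<Rightarrow> ('a \<Rightarrow> 'b::real_normed_vector) \<Rightarrow> bool" where
  "Ck_on 0 S f = continuous_on S f"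
| "Ck_on (Suc k) S f =
     (\<exists>f'. (\<forall>x\<in>S. (f has_derivative f' x) (at x within S)) \<and> (\<forall>v. Ck_on k S (\<lambda>x. f' x v)))"

definition smooth_on :: "'a::real_normed_vector set \<Rightarrow> ('a \<Rightarrow> 'b::real_normed_vector) \<Rightarrow> bool" where
  "smooth_on S f \<longleftrightarrow> (\<forall>k. Ck_on k S f)"

definition deriv2 :: "('a::real_normed_vector \<Rightarrow> 'b::real_normed_vector) \<Rightarrow> 'a \<Rightarrow> 'a \<Rightarrow> 'a \<Rightarrow> 'b" where
  "deriv2 f x v w = frechet_derivative (\<lambda>y. frechet_derivative f (at y) v) (at x) w"


section \<open>Hilbert manifolds\<close>

text \<open>
  A manifold is a type \<open>'m\<close> (Hausdorff by its sort) with an atlas of charts (domain, coordinate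
  map) into a Hilbert space \<open>'e\<close>.
\<close>

type_synonym ('m, 'e) chart = "'m set \<times> ('m \<Rightarrow> 'e)"

definition cinv :: "('m, 'e) chart \<Rightarrow> 'e \<Rightarrow> 'm" where
  "cinv c = inv_into (fst c) (snd c)"

definition hilbert_manifold ::
    "('m::t2_space, 'e::{real_inner,complete_space}) chart set \<Rightarrow> bool" where
  "hilbert_manifold A \<longleftrightarrow>
     (\<forall>c\<in>A. open (fst c) \<and> open (snd c ` fst c)
        \<and> homeomorphism (fst c) (snd c ` fst c) (snd c) (cinv c))
   \<and> (\<Union>c\<in>A. fst c) = UNIV
   \<and> (\<forall>c\<in>A. \<forall>d\<in>A. smooth_on (snd c ` (fst c \<inter> fst d)) (snd d \<circ> cinv c))"

definition charts_at :: "('m, 'e) chart set \<Rightarrow> 'm \<Rightarrow> ('m, 'e) chart set" where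
  "charts_at A u = {c\<in>A. u \<in> fst c}"

definition vec_atlas :: "('v, 'v) chart set" where
  "vec_atlas = {(UNIV, id)}"

definition prod_atlas :: "('m, 'e) chart set \<Rightarrow> ('n, 'f) chart set \<Rightarrow> ('m \<times> 'n, 'e \<times> 'f) chart set" where
  "prod_atlas A B = {(fst c \<times> fst d, map_prod (snd c) (snd d)) | c d. c \<in> A \<and> d \<in> B}"

definition smooth_map ::
    "('m::topological_space, 'e::real_normed_vector) chart set
      \<Rightarrow> ('n::topological_space, 'f::real_normed_vector) chart set \<Rightarrow> ('m \<Rightarrow> 'n) \<Rightarrow> bool" where
  "smooth_map A B f \<longleftrightarrow> continuous_on UNIV f
     \<and> (\<forall>c\<in>A. \<forall>d\<in>B. smooth_on (snd c ` (fst c \<inter> f -` fst d)) (snd d \<circ> f \<circ> cinv c))"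

text \<open>Smoothness on \<open>I \<times> M\<close> of a time-dependent vector-valued function on \<open>M\<close>.\<close>

definition smooth_family ::
    "real set \<Rightarrow> ('m, 'e::real_normed_vector) chart set \<Rightarrow> (real \<Rightarrow> 'm \<Rightarrow> 'v::real_normed_vector) \<Rightarrow> bool" where
  "smooth_family I A F \<longleftrightarrow>
     (\<forall>c\<in>A. smooth_on (I \<times> (snd c ` fst c)) (\<lambda>(t, y). F t (cinv c y)))"

text \<open>
  A tangent vector at \<open>u\<close> is the family of its coordinate representatives, one for each chart
  around \<open>u\<close>, related by the differentials of the coordinate changes (and \<open>0\<close> at the irrelevant
  arguments).
\<close>

type_synonym ('m, 'e) tvec = "('m, 'e) chart \<Rightarrow> 'e"

definition tangent_space ::
    "('m, 'e::real_normed_vector) chart set \<Rightarrow> 'm \<Rightarrow> ('m, 'e) tvec set" where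
  "tangent_space A u = {X.
     (\<forall>c. c \<notin> charts_at A u \<longrightarrow> X c = 0)
   \<and> (\<forall>c\<in>charts_at A u. \<forall>d\<in>charts_at A u.
        X d = frechet_derivative (snd d \<circ> cinv c) (at (snd c u)) (X c))}"

text \<open>The differential \<open>f\<^sub>* X\<close>; by the chain rule the choice of chart is immaterial.\<close>

definition pushforward ::
    "('m, 'e::real_normed_vector) chart set \<Rightarrow> ('m \<Rightarrow> 'v::real_normed_vector) \<Rightarrow> 'm \<Rightarrow> ('m, 'e) tvec \<Rightarrow> 'v" where
  "pushforward A f u X =
     (let c = (SOME c. c \<in> charts_at A u)
      in frechet_derivative (f \<circ> cinv c) (at (snd c u)) (X c))"

definition tangent_image ::
    "('m, 'e::real_normed_vector) chart set \<Rightarrow> ('m \<Rightarrow> 'v::real_normed_vector) \<Rightarrow> 'm \<Rightarrow> 'v set" where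
  "tangent_image A f u = pushforward A f u ` tangent_space A u"

definition normal_subspace ::
    "('m, 'e::real_normed_vector) chart set \<Rightarrow> ('m \<Rightarrow> 'v::real_inner) \<Rightarrow> 'm \<Rightarrow> 'v set" where
  "normal_subspace A f u = {v. \<forall>w\<in>tangent_image A f u. inner v w = 0}"

text \<open>In a Hilbert space a closed subspace splits, so closedness of the image suffices.\<close>

definition immersion ::
    "('m::topological_space, 'e::real_normed_vector) chart set \<Rightarrow> ('m \<Rightarrow> 'v::real_inner) \<Rightarrow> bool" where
  "immersion A f \<longleftrightarrow> smooth_map A vec_atlas f
     \<and> (\<forall>u. inj_on (pushforward A f u) (tangent_space A u) \<and> closed (tangent_image A f u))"

definition induced_metric ::
    "('m, 'e::real_normed_vector) chart set \<Rightarrow> ('m \<Rightarrow> 'v::real_inner) \<Rightarrow> 'm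
      \<Rightarrow> ('m, 'e) tvec \<Rightarrow> ('m, 'e) tvec \<Rightarrow> real" where
  "induced_metric A f u X Y = inner (pushforward A f u X) (pushforward A f u Y)"

text \<open>\<open>Y\<close> is the gradient at \<open>u\<close> of the function \<open>h\<close> with respect to the metric \<open>g\<close> on \<open>T\<^sub>u M\<close>.\<close>

definition is_gradient ::
    "('m, 'e::real_normed_vector) chart set \<Rightarrow> (('m, 'e) tvec \<Rightarrow> ('m, 'e) tvec \<Rightarrow> real)
      \<Rightarrow> ('m \<Rightarrow> real) \<Rightarrow> 'm \<Rightarrow> ('m, 'e) tvec \<Rightarrow> bool" where
  "is_gradient A g h u Y \<longleftrightarrow> Y \<in> tangent_space A u
     \<and> (\<forall>c\<in>charts_at A u. (h \<circ> cinv c) differentiable (at (snd c u)))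
     \<and> (\<forall>X\<in>tangent_space A u. pushforward A h u X = g Y X)"

definition gradient ::
    "('m, 'e::real_normed_vector) chart set \<Rightarrow> (('m, 'e) tvec \<Rightarrow> ('m, 'e) tvec \<Rightarrow> real)
      \<Rightarrow> ('m \<Rightarrow> real) \<Rightarrow> 'm \<Rightarrow> ('m, 'e) tvec" where
  "gradient A g h u = (THE Y. is_gradient A g h u Y)"


section \<open>Regularizable immersions and the regularized mean curvature flow\<close>

text \<open>
  The shape operator \<open>A\<^sub>v\<close>, as an operator on \<open>f\<^sub>* T\<^sub>u M\<close>:
  \<open>\<langle>A\<^sub>v (f\<^sub>* X), f\<^sub>* Y\<rangle> = \<langle>II(X, Y), v\<rangle>\<close>, where in coordinates the second fundamental form
  \<open>II(X, Y)\<close> is the normal component of the second derivative of \<open>f\<close>.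
\<close>

definition shape_operator ::
    "('m, 'e::real_normed_vector) chart set \<Rightarrow> ('m \<Rightarrow> 'v::real_inner) \<Rightarrow> 'm \<Rightarrow> 'v \<Rightarrow> 'v \<Rightarrow> 'v" where
  "shape_operator A f u v w =
     (THE z. z \<in> tangent_image A f u \<and>
        (\<forall>c\<in>charts_at A u. \<forall>X\<in>tangent_space A u. \<forall>Y\<in>tangent_space A u.
           pushforward A f u X = w \<longrightarrow>
           inner z (pushforward A f u Y) = inner (deriv2 (f \<circ> cinv c) (snd c u) (X c) (Y c)) v))"

definition compact_operator_on :: "'v::real_normed_vector set \<Rightarrow> ('v \<Rightarrow> 'v) \<Rightarrow> bool" where
  "compact_operator_on S B \<longleftrightarrow> compact (closure (B ` (S \<inter> cball 0 1)))"

text \<open>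
  \<open>\<mu>p\<close> decreases to \<open>0\<close> through the positive eigenvalues of the compact self-adjoint operator
  \<open>B\<close> on \<open>S\<close>, \<open>\<mu>m\<close> increases to \<open>0\<close> through the negative ones, each repeated according to its
  multiplicity.  Either sequence continues with zeros if there are only finitely many
  eigenvalues of its sign.
\<close>

definition spectrum_seqs ::
    "'v::real_normed_vector set \<Rightarrow> ('v \<Rightarrow> 'v) \<Rightarrow> (nat \<Rightarrow> real) \<Rightarrow> (nat \<Rightarrow> real) \<Rightarrow> bool" where
  "spectrum_seqs S B \<mu>p \<mu>m \<longleftrightarrow>
     decseq \<mu>p \<and> incseq \<mu>m \<and> (\<forall>i. \<mu>m i \<le> 0 \<and> 0 \<le> \<mu>p i)
   \<and> (\<forall>l>0. finite {i. \<mu>p i = l} \<and> card {i. \<mu>p i = l} = dim {w\<in>S. B w = l *\<^sub>R w})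
   \<and> (\<forall>l<0. finite {i. \<mu>m i = l} \<and> card {i. \<mu>m i = l} = dim {w\<in>S. B w = l *\<^sub>R w})"

definition has_regularized_trace :: "'v::real_normed_vector set \<Rightarrow> ('v \<Rightarrow> 'v) \<Rightarrow> real \<Rightarrow> bool" where
  "has_regularized_trace S B r \<longleftrightarrow>
     (\<exists>\<mu>p \<mu>m. spectrum_seqs S B \<mu>p \<mu>m \<and> (\<lambda>i. \<mu>p i + \<mu>m i) sums r)"

text \<open>Existence of \<open>Tr B\<^sup>2\<close>, the sum of the squares of the eigenvalues of \<open>B\<close>.\<close>

definition trace_square_exists :: "'v::real_normed_vector set \<Rightarrow> ('v \<Rightarrow> 'v) \<Rightarrow> bool" where
  "trace_square_exists S B \<longleftrightarrow>
     (\<exists>\<mu>p \<mu>m. spectrum_seqs S B \<mu>p \<mu>m \<and> summable (\<lambda>i. (\<mu>p i)\<^sup>2 + (\<mu>m i)\<^sup>2))"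

definition regularizable ::
    "('m::topological_space, 'e::real_normed_vector) chart set \<Rightarrow> ('m \<Rightarrow> 'v::real_inner) \<Rightarrow> bool" where
  "regularizable A f \<longleftrightarrow> immersion A f \<and>
     (\<forall>u. (\<exists>B. finite B \<and> normal_subspace A f u \<subseteq> span B)
        \<and> (\<forall>v\<in>normal_subspace A f u.
             compact_operator_on (tangent_image A f u) (shape_operator A f u v)
           \<and> (\<exists>r. has_regularized_trace (tangent_image A f u) (shape_operator A f u v) r)
           \<and> trace_square_exists (tangent_image A f u) (shape_operator A f u v)))"

definition is_regularized_mean_curvature ::
    "('m, 'e::real_normed_vector) chart set \<Rightarrow> ('m \<Rightarrow> 'v::real_inner) \<Rightarrow> ('m \<Rightarrow> 'v) \<Rightarrow> bool" where
  "is_regularized_mean_curvature A f H \<longleftrightarrow>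
     (\<forall>u. H u \<in> normal_subspace A f u
        \<and> (\<forall>v\<in>normal_subspace A f u.
             has_regularized_trace (tangent_image A f u) (shape_operator A f u v) (inner (H u) v)))"

definition minimal_regularizable ::
    "('m::topological_space, 'e::real_normed_vector) chart set \<Rightarrow> ('m \<Rightarrow> 'v::real_inner) \<Rightarrow> bool" where
  "minimal_regularizable A f \<longleftrightarrow>
     regularizable A f \<and> is_regularized_mean_curvature A f (\<lambda>_. 0)"

definition time_interval :: "ereal \<Rightarrow> real set" where
  "time_interval T = {t. 0 \<le> t \<and> ereal t < T}"

definition regularized_mcf ::
    "('m::topological_space, 'e::real_normed_vector) chart set \<Rightarrow> ereal
      \<Rightarrow> (real \<Rightarrow> 'm \<Rightarrow> 'v::real_inner) \<Rightarrow> (real \<Rightarrow> 'm \<Rightarrow> 'v) \<Rightarrow> bool" where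
  "regularized_mcf A T F H \<longleftrightarrow>
     smooth_family (time_interval T) A F
   \<and> (\<forall>t\<in>time_interval T. regularizable A (F t) \<and> is_regularized_mean_curvature A (F t) (H t))
   \<and> (\<forall>t\<in>time_interval T. \<forall>u.
        ((\<lambda>s. F s u) has_vector_derivative H t u) (at t within time_interval T))"


section \<open>Hilbert Lie group actions\<close>

definition hilbert_lie_group ::
    "('g::t2_space, 'h::{real_inner,complete_space}) chart set \<Rightarrow> 'g monoid \<Rightarrow> bool" where
  "hilbert_lie_group AG G \<longleftrightarrow> hilbert_manifold AG \<and> group G \<and> carrier G = UNIV
     \<and> smooth_map (prod_atlas AG AG) AG (\<lambda>(a, b). a \<otimes>\<^bsub>G\<^esub> b)
     \<and> smooth_map AG AG (m_inv G)"

definition smooth_action ::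
    "('g::topological_space, 'h::real_normed_vector) chart set \<Rightarrow> 'g monoid
      \<Rightarrow> ('m::topological_space, 'e::real_normed_vector) chart set \<Rightarrow> ('g \<Rightarrow> 'm \<Rightarrow> 'm) \<Rightarrow> bool" where
  "smooth_action AG G A act \<longleftrightarrow> group_action G UNIV act
     \<and> smooth_map (prod_atlas AG A) A (\<lambda>(a, x). act a x)"

definition isometric_action :: "('g \<Rightarrow> 'v::metric_space \<Rightarrow> 'v) \<Rightarrow> bool" where
  "isometric_action act \<longleftrightarrow> (\<forall>a x y. dist (act a x) (act a y) = dist x y)"

definition almost_free :: "'g monoid \<Rightarrow> ('g \<Rightarrow> 'v \<Rightarrow> 'v) \<Rightarrow> bool" where
  "almost_free G act \<longleftrightarrow> (\<forall>x. finite (stabilizer G act x))"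

text \<open>
  Stabilizers being finite, \<open>a \<mapsto> a \<cdot> x\<close> is a finite covering of the orbit of \<open>x\<close>, so the orbit
  as a submanifold is described by the immersion \<open>a \<mapsto> a \<cdot> x\<close> of \<open>G\<close>.
\<close>

definition orbit_immersion :: "('g \<Rightarrow> 'v \<Rightarrow> 'v) \<Rightarrow> 'v \<Rightarrow> 'g \<Rightarrow> 'v" where
  "orbit_immersion act x = (\<lambda>a. act a x)"

definition vertical_space ::
    "('g, 'h::real_normed_vector) chart set \<Rightarrow> 'g monoid \<Rightarrow> ('g \<Rightarrow> 'v::real_inner \<Rightarrow> 'v) \<Rightarrow> 'v \<Rightarrow> 'v set" where
  "vertical_space AG G act x = tangent_image AG (orbit_immersion act x) \<one>\<^bsub>G\<^esub>"

definition horizontal_space ::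
    "('g, 'h::real_normed_vector) chart set \<Rightarrow> 'g monoid \<Rightarrow> ('g \<Rightarrow> 'v::real_inner \<Rightarrow> 'v) \<Rightarrow> 'v \<Rightarrow> 'v set" where
  "horizontal_space AG G act x = normal_subspace AG (orbit_immersion act x) \<one>\<^bsub>G\<^esub>"

definition quotient_topology :: "('a::topological_space \<Rightarrow> 'q) \<Rightarrow> 'q topology" where
  "quotient_topology p = topology (\<lambda>U. U \<subseteq> range p \<and> open (p -` U))"

lemma istopology_quotient: "istopology (\<lambda>U. U \<subseteq> range p \<and> open (p -` U))"
  unfolding istopology_def by (auto simp: vimage_Union intro!: open_Int open_UN)

lemma openin_quotient_topology:
  "openin (quotient_topology p) U \<longleftrightarrow> U \<subseteq> range p \<and> open (p -` U)"
  by (simp only: quotient_topology_def topology_inverse'[OF istopology_quotient])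

lemma topspace_quotient_topology: "topspace (quotient_topology p) = range p"
proof (rule antisym)
  show "topspace (quotient_topology p) \<subseteq> range p"
    by (rule conjunct1[OF iffD1[OF openin_quotient_topology openin_topspace]])
  have vimage_range: "p -` range p = UNIV" by auto
  have "openin (quotient_topology p) (range p)"
    by (simp only: openin_quotient_topology vimage_range open_UNIV order_refl simp_thms)
  then show "range p \<subseteq> topspace (quotient_topology p)" by (rule openin_subset)
qed

text \<open>The orbit space \<open>V/G\<close>; its points are the orbits, and the orbit map is \<open>orbit G act\<close>.\<close>

definition orbit_topology :: "'g monoid \<Rightarrow> ('g \<Rightarrow> 'v::topological_space \<Rightarrow> 'v) \<Rightarrow> 'v set topology" where
  "orbit_topology G act = quotient_topology (orbit G act)"


section \<open>Riemannian orbifolds\<close>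

text \<open>
  An orbifold chart of a space \<open>X\<close>: a finite group of diffeomorphisms \<open>ogrp\<close> of an open set
  \<open>odom\<close> of Euclidean space, a projection \<open>oproj\<close> inducing a homeomorphism of \<open>odom / ogrp\<close>
  onto an open subset of \<open>X\<close>, and the local representative \<open>omet\<close> of the Riemannian orbimetric.
\<close>

record ('b, 'q) ochart =
  odom :: "'b set"
  ogrp :: "('b \<Rightarrow> 'b) set"
  oproj :: "'b \<Rightarrow> 'q"
  omet :: "'b \<Rightarrow> 'b \<Rightarrow> 'b \<Rightarrow> real"

definition riemannian_metric_on :: "'b::euclidean_space set \<Rightarrow> ('b \<Rightarrow> 'b \<Rightarrow> 'b \<Rightarrow> real) \<Rightarrow> bool" where
  "riemannian_metric_on U g \<longleftrightarrow>
     (\<forall>a b. smooth_on U (\<lambda>y. g y a b))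
   \<and> (\<forall>y\<in>U. bilinear (g y) \<and> (\<forall>a b. g y a b = g y b a) \<and> (\<forall>a. a \<noteq> 0 \<longrightarrow> 0 < g y a a))"

definition riemannian_isometry_on ::
    "'b::euclidean_space set \<Rightarrow> ('b \<Rightarrow> 'b \<Rightarrow> 'b \<Rightarrow> real) \<Rightarrow> ('b \<Rightarrow> 'b \<Rightarrow> 'b \<Rightarrow> real) \<Rightarrow> ('b \<Rightarrow> 'b) \<Rightarrow> bool" where
  "riemannian_isometry_on W g g' k \<longleftrightarrow>
     open W \<and> inj_on k W \<and> open (k ` W) \<and> smooth_on W k \<and> smooth_on (k ` W) (inv_into W k)
   \<and> (\<forall>y\<in>W. \<forall>a b. g' (k y) (frechet_derivative k (at y) a) (frechet_derivative k (at y) b) = g y a b)"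

definition orbifold_chart :: "'q topology \<Rightarrow> ('b::euclidean_space, 'q) ochart \<Rightarrow> bool" where
  "orbifold_chart X c \<longleftrightarrow>
     open (odom c) \<and> connected (odom c)
   \<and> riemannian_metric_on (odom c) (omet c)
   \<and> finite (ogrp c) \<and> subgroup (ogrp c) (BijGroup (odom c))
   \<and> (\<forall>\<gamma>\<in>ogrp c. riemannian_isometry_on (odom c) (omet c) (omet c) \<gamma>)
   \<and> continuous_map (top_of_set (odom c)) X (oproj c)
   \<and> open_map (top_of_set (odom c)) X (oproj c)
   \<and> (\<forall>y\<in>odom c. \<forall>z\<in>odom c. oproj c y = oproj c z \<longleftrightarrow> (\<exists>\<gamma>\<in>ogrp c. z = \<gamma> y))"

definition riemannian_orbifold :: "'q topology \<Rightarrow> ('b::euclidean_space, 'q) ochart set \<Rightarrow> bool" where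
  "riemannian_orbifold X C \<longleftrightarrow>
     Hausdorff_space X
   \<and> (\<forall>c\<in>C. orbifold_chart X c)
   \<and> (\<Union>c\<in>C. oproj c ` odom c) = topspace X
   \<and> (\<forall>c\<in>C. \<forall>d\<in>C. \<forall>y\<in>odom c. \<forall>z\<in>odom d. oproj c y = oproj d z \<longrightarrow>
        (\<exists>W k. y \<in> W \<and> W \<subseteq> odom c \<and> riemannian_isometry_on W (omet c) (omet d) k \<and> k y = z
           \<and> k ` W \<subseteq> odom d \<and> (\<forall>w\<in>W. oproj d (k w) = oproj c w)))"

text \<open>
  The orbit map has, near every point and over every chart, smooth local lifts whose
  differential vanishes on vertical vectors and maps the horizontal space isometrically onto
  the tangent space of the chart.
\<close>

definition riemannian_orbisubmersion ::
    "('g, 'h::real_normed_vector) chart set \<Rightarrow> 'g monoid \<Rightarrow> ('g \<Rightarrow> 'v::real_inner \<Rightarrow> 'v)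
      \<Rightarrow> ('b::euclidean_space, 'v set) ochart set \<Rightarrow> bool" where
  "riemannian_orbisubmersion AG G act C \<longleftrightarrow>
     (\<forall>x. \<forall>c\<in>C. \<forall>y\<in>odom c. oproj c y = orbit G act x \<longrightarrow>
        (\<exists>W p. open W \<and> x \<in> W \<and> smooth_on W p \<and> p ` W \<subseteq> odom c \<and> p x = y
           \<and> (\<forall>w\<in>W. oproj c (p w) = orbit G act w
                \<and> (\<forall>a\<in>vertical_space AG G act w. frechet_derivative p (at w) a = 0)
                \<and> bij_betw (frechet_derivative p (at w)) (horizontal_space AG G act w) UNIV
                \<and> (\<forall>a\<in>horizontal_space AG G act w. \<forall>b\<in>horizontal_space AG G act w.
                     omet c (p w) (frechet_derivative p (at w) a) (frechet_derivative p (at w) b)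
                       = inner a b))))"

text \<open>Christoffel map of the Levi-Civita connection, by the Koszul formula for constant fields.\<close>

definition christoffel ::
    "('b::euclidean_space \<Rightarrow> 'b \<Rightarrow> 'b \<Rightarrow> real) \<Rightarrow> 'b \<Rightarrow> 'b \<Rightarrow> 'b \<Rightarrow> 'b" where
  "christoffel g y a b = (THE z. \<forall>k. 2 * g y z k =
       frechet_derivative (\<lambda>x. g x b k) (at y) a
     + frechet_derivative (\<lambda>x. g x a k) (at y) b
     - frechet_derivative (\<lambda>x. g x a b) (at y) k)"

text \<open>
  \<open>\<eta>\<close> is the mean curvature vector (trace of the second fundamental form), at the parameter
  value \<open>y\<close>, of the hypersurface parametrized by a map \<open>q\<close> of rank \<open>DIM('b) - 1\<close>.  The parameter
  space may be larger than the hypersurface: \<open>q\<close> is only assumed to have rank \<open>DIM('b) - 1\<close>, and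
  the vectors in \<open>B\<close> are mapped to an orthonormal basis of its tangent space.
\<close>

definition is_hypersurface_mean_curvature ::
    "('b::euclidean_space \<Rightarrow> 'b \<Rightarrow> 'b \<Rightarrow> real) \<Rightarrow> ('e::real_normed_vector \<Rightarrow> 'b) \<Rightarrow> 'e \<Rightarrow> 'b \<Rightarrow> bool" where
  "is_hypersurface_mean_curvature g q y \<eta> \<longleftrightarrow>
     (let Dq = frechet_derivative q (at y); N = {\<nu>. \<forall>a. g (q y) \<nu> (Dq a) = 0} in
        Suc (dim (range Dq)) = DIM('b) \<and> \<eta> \<in> N \<and>
        (\<exists>B. finite B \<and> card B = dim (range Dq)
           \<and> (\<forall>a\<in>B. \<forall>b\<in>B. g (q y) (Dq a) (Dq b) = (if a = b then 1 else 0))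
           \<and> (\<forall>\<nu>\<in>N. g (q y) \<eta> \<nu> =
                (\<Sum>a\<in>B. g (q y) (deriv2 q y a a + christoffel g (q y) (Dq a) (Dq a)) \<nu>))))"

text \<open>
  Mean curvature flow of hypersurfaces in a Riemannian orbifold with atlas \<open>C\<close>.  For a flow
  \<open>f\<^sub>t : M/G \<rightarrow> X\<close> of hypersurface immersions, \<open>q t\<close> is the composite of \<open>f\<^sub>t\<close> with the quotient
  map of \<open>M\<close> to \<open>M/G\<close>; locally \<open>q\<close> lifts to a smooth family in a chart that moves by its mean
  curvature.
\<close>

definition orbifold_mcf ::
    "('b::euclidean_space, 'q) ochart set \<Rightarrow> ('m::topological_space, 'e::real_normed_vector) chart set
      \<Rightarrow> ereal \<Rightarrow> (real \<Rightarrow> 'm \<Rightarrow> 'q) \<Rightarrow> bool" where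
  "orbifold_mcf C A T q \<longleftrightarrow>
     (\<forall>t0\<in>time_interval T. \<forall>u0.
        \<exists>c\<in>C. \<exists>m\<in>charts_at A u0. \<exists>J W k.
          open J \<and> t0 \<in> J \<and> open W \<and> u0 \<in> W \<and> W \<subseteq> fst m
        \<and> smooth_on ((J \<inter> time_interval T) \<times> (snd m ` W)) (\<lambda>(t, y). k t y)
        \<and> (\<forall>t\<in>J \<inter> time_interval T. \<forall>u\<in>W.
             k t (snd m u) \<in> odom c \<and> oproj c (k t (snd m u)) = q t u
           \<and> (\<exists>\<eta>. is_hypersurface_mean_curvature (omet c) (k t) (snd m u) \<eta>
                \<and> ((\<lambda>s. k s (snd m u)) has_vector_derivative \<eta>) (at t within time_interval T))))"

text \<open>
  \<open>F\<close> moves every point along the horizontal lift of its trajectory under the mean curvature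
  flow in \<open>V/G\<close> of the hypersurface induced by \<open>F 0\<close>.
\<close>

definition horizontal_lift_flow ::
    "('g, 'h::real_normed_vector) chart set \<Rightarrow> 'g monoid \<Rightarrow> ('g \<Rightarrow> 'v::real_inner \<Rightarrow> 'v)
      \<Rightarrow> ('b::euclidean_space, 'v set) ochart set
      \<Rightarrow> ('m::topological_space, 'e::real_normed_vector) chart set
      \<Rightarrow> ereal \<Rightarrow> (real \<Rightarrow> 'm \<Rightarrow> 'v) \<Rightarrow> bool" where
  "horizontal_lift_flow AG G act C A T F \<longleftrightarrow>
     (\<forall>t\<in>time_interval T. \<forall>u. \<exists>w\<in>horizontal_space AG G act (F t u).
        ((\<lambda>s. F s u) has_vector_derivative w) (at t within time_interval T))
   \<and> orbifold_mcf C A T (\<lambda>t u. orbit G act (F t u))"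

end

theory Submission
  imports Defs
begin

text \<open>
  Write \<open>H = \<rho> \<xi>\<close> with \<open>\<rho> = \<parallel>H\<parallel>\<close>.  The hypersurface moves with velocity \<open>\<rho> \<xi>\<close>, and the
  vector \<open>\<xi>\<close> is normal and of length one.  The constant length
  gives \<open>\<langle>\<partial>\<^sub>t \<xi>, \<xi>\<rangle> = 0\<close>.  For a tangent vector \<open>X\<close> of \<open>M\<close>, differentiating
  \<open>\<langle>\<xi>, F\<^sub>* X\<rangle> = 0\<close> in time and using \<open>\<partial>\<^sub>t (F\<^sub>* X) = D\<^sub>X (\<partial>\<^sub>t F)\<close> gives
  \<open>\<langle>\<partial>\<^sub>t \<xi>, F\<^sub>* X\<rangle> = - \<langle>\<xi>, D\<^sub>X (\<rho> \<xi>)\<rangle> = - d\<rho>(X)\<close>,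
  because \<open>\<langle>\<xi>, D\<^sub>X \<xi>\<rangle> = 0\<close>.  Hence, once \<open>\<partial>\<^sub>t \<xi>\<close> is known to be \<open>- F\<^sub>* Y\<close> for some tangent
  vector \<open>Y\<close>, that \<open>Y\<close> is the gradient of \<open>\<rho>\<close>; it is unique because \<open>F\<^sub>*\<close> is injective.

  Three points need care.  The existence of \<open>Y\<close> is a matter of infinite dimensions: a vector
  orthogonal to \<open>\<xi>\<close>, that is, to the whole one-dimensional normal space, lies in the double
  orthogonal complement of the image of \<open>F\<^sub>*\<close>, which is that image because it is a closed
  subspace of a Hilbert space (\<open>closed_subspace_double_complement\<close>).  The interchange of
  derivatives is needed at the initial time too, where time derivatives are one-sided
  (\<open>mixed_derivatives_symmetric\<close>).  Finally \<open>\<rho>\<close> is differentiable even at the zeros of \<open>H\<close>,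
  where a norm need not be, because \<open>\<rho> = \<langle>\<partial>\<^sub>t F, \<xi>\<rangle>\<close> with a smooth \<open>\<xi>\<close>.  The computation
  in coordinates is \<open>unit_normal_evolution\<close>.
\<close>

section \<open>Closed subspaces of a Hilbert space\<close>

text \<open>
  Bounded closed sets need not be compact here, so a minimizer is found by completeness: the
  near-minimizers form nested closed sets, whose diameters tend to \<open>0\<close> by the parallelogram law
  since the midpoint of two of them again lies in \<open>S\<close>.
\<close>

lemma closest_point_in_closed_subspace:
  fixes S :: "'v::{real_inner,complete_space} set"
  assumes S: "closed S" "subspace S"
  obtains a where "a \<in> S" "\<And>z. z \<in> S \<Longrightarrow> dist v a \<le> dist v z"
proof -
  define d where "d = (INF z\<in>S. (dist v z)\<^sup>2)"
  define K where "K n = {z\<in>S. (dist v z)\<^sup>2 \<le> d + 1 / real (Suc n)}" for n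
  have bdd: "bdd_below ((\<lambda>z. (dist v z)\<^sup>2) ` S)"
    by (rule bdd_belowI[of _ 0]) auto
  have ne: "S \<noteq> {}"
    using subspace_0[OF S(2)] by auto
  have d_le: "d \<le> (dist v z)\<^sup>2" if "z \<in> S" for z
    unfolding d_def using bdd that by (rule cINF_lower)
  obtain a where a: "\<And>n. a \<in> K n"
  proof (rule decreasing_closed_nest[of K])
    fix n
    have eq: "K n = S \<inter> {z. (dist v z)\<^sup>2 \<le> d + 1 / real (Suc n)}"
      by (auto simp: K_def)
    show "closed (K n)"
      unfolding eq by (intro closed_Int S closed_Collect_le continuous_intros)
    have "(INF z\<in>S. (dist v z)\<^sup>2) < d + 1 / real (Suc n)"
      unfolding d_def by simp
    then obtain z where "z \<in> S" "(dist v z)\<^sup>2 < d + 1 / real (Suc n)"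
      unfolding cINF_less_iff[OF ne bdd] by blast
    then show "K n \<noteq> {}"
      by (auto simp: K_def intro!: exI[of _ z])
  next
    fix m n :: nat
    assume "m \<le> n"
    then have "1 / real (Suc n) \<le> 1 / real (Suc m)"
      by (simp add: frac_le)
    then show "K n \<subseteq> K m"
      by (auto simp: K_def)
  next
    fix \<epsilon> :: real
    assume \<epsilon>: "\<epsilon> > 0"
    then obtain n where n: "1 / real (Suc n) < \<epsilon>\<^sup>2 / 4"
      using nat_approx_posE[of "\<epsilon>\<^sup>2 / 4"] by auto
    have "dist x y < \<epsilon>" if "x \<in> K n" "y \<in> K n" for x y
    proof -
      have mid: "(1/2) *\<^sub>R (x + y) \<in> S"
        using that S(2) by (auto simp: K_def intro!: subspace_scale subspace_add)
      \<comment> \<open>the parallelogram law for \<open>v - x\<close> and \<open>v - y\<close>\<close>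
      have "(dist x y)\<^sup>2 = 2 * (dist v x)\<^sup>2 + 2 * (dist v y)\<^sup>2 - 4 * (dist v ((1/2) *\<^sub>R (x + y)))\<^sup>2"
        unfolding dist_norm power2_norm_eq_inner by (simp add: algebra_simps inner_commute)
      also have "\<dots> \<le> 4 / real (Suc n)"
        using that d_le[OF mid] by (auto simp: K_def)
      also have "\<dots> < \<epsilon>\<^sup>2"
        using n by simp
      finally show ?thesis
        using \<epsilon> by (simp add: power2_less_imp_less)
    qed
    then show "\<exists>n. \<forall>x\<in>K n. \<forall>y\<in>K n. dist x y < \<epsilon>"
      by blast
  qed blast
  have "(dist v a)\<^sup>2 \<le> d"
  proof (rule field_le_epsilon)
    fix e :: real
    assume "0 < e"
    then obtain n where "1 / real (Suc n) < e"
      using nat_approx_posE by blast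
    then show "(dist v a)\<^sup>2 \<le> d + e"
      using a[of n] by (auto simp: K_def)
  qed
  then have "dist v a \<le> dist v z" if "z \<in> S" for z
    using d_le[OF that] by (metis order_trans power2_le_imp_le zero_le_dist)
  moreover have "a \<in> S"
    using a[of 0] by (simp add: K_def)
  ultimately show ?thesis
    using that by blast
qed

text \<open>
  The residual of the closest-point projection onto \<open>S\<close> is orthogonal to \<open>S\<close>, so a vector
  orthogonal to \<open>S\<^sup>\<bottom>\<close> has residual zero.
\<close>

lemma closed_subspace_double_complement:
  fixes S :: "'v::{real_inner,complete_space} set"
  assumes S: "closed S" "subspace S"
    and v: "\<And>n. (\<forall>s\<in>S. inner n s = 0) \<Longrightarrow> inner v n = 0"
  shows "v \<in> S"
proof -
  obtain a where a: "a \<in> S" "\<And>z. z \<in> S \<Longrightarrow> dist v a \<le> dist v z"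
    using closest_point_in_closed_subspace[OF S, of v] by blast
  have half: "inner (v - a) s \<le> 0" if "s \<in> S" for s
    using any_closest_point_dot[OF subspace_imp_convex[OF S(2)] S(1) a(1), of "a + s" v] a that S(2)
    by (auto simp: subspace_add)
  have orth: "inner (v - a) s = 0" if "s \<in> S" for s
    using half[OF that] half[OF subspace_neg[OF S(2) that]] by simp
  have "inner (v - a) (v - a) = 0"
    using v[of "v - a"] orth[OF a(1)] orth by (simp add: inner_diff_right inner_commute)
  then show ?thesis
    using a(1) by simp
qed

lemma dim_1_scaleR_of_nonzero:
  fixes N :: "'v::real_vector set"
  assumes "dim N = 1" "x \<in> N" "x \<noteq> 0" "v \<in> N"
  obtains k where "v = k *\<^sub>R x"
proof -
  obtain B where B: "N \<subseteq> span B" "card B = 1"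
    using basis_exists[of N] assms(1) by metis
  then obtain b where "B = {b}"
    by (auto simp: card_1_singleton_iff)
  with B(1) have "N \<subseteq> range (\<lambda>k. k *\<^sub>R b)"
    by (simp add: span_singleton)
  with assms(2,4) obtain k l where k: "x = k *\<^sub>R b" and l: "v = l *\<^sub>R b"
    by blast
  with assms(3) have "v = (l / k) *\<^sub>R x"
    by auto
  then show ?thesis
    by (rule that)
qed


section \<open>Symmetry of mixed derivatives at a corner\<close>

text \<open>Two applications of the mean value theorem, along \<open>a\<close> and then along \<open>b\<close>.\<close>

lemma second_difference_eq_mixed_derivative:
  fixes f :: "'a::real_normed_vector \<Rightarrow> real"
  assumes f': "\<And>y. y \<in> S \<Longrightarrow> (f has_derivative f' y) (at y within S)"
    and g': "\<And>y. y \<in> S \<Longrightarrow> ((\<lambda>z. f' z a) has_derivative g' y) (at y within S)"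
    and h: "0 < h"
    and S: "\<And>s r. 0 \<le> s \<Longrightarrow> s \<le> h \<Longrightarrow> 0 \<le> r \<Longrightarrow> r \<le> h \<Longrightarrow> x + s *\<^sub>R a + r *\<^sub>R b \<in> S"
  obtains s r where "0 < s" "s < h" "0 < r" "r < h"
    "f (x + h *\<^sub>R a + h *\<^sub>R b) - f (x + h *\<^sub>R a) - f (x + h *\<^sub>R b) + f x
       = h * h * g' (x + s *\<^sub>R a + r *\<^sub>R b) b"
proof -
  have along_a: "((\<lambda>s. f (x + s *\<^sub>R a + r *\<^sub>R b)) has_derivative
      (\<lambda>\<delta>. f' (x + s *\<^sub>R a + r *\<^sub>R b) (\<delta> *\<^sub>R a))) (at s within {0..h})"
    if "0 \<le> s" "s \<le> h" "0 \<le> r" "r \<le> h" for s r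
    by (rule has_derivative_in_compose2[where t = S and g' = f'])
       (use that f' S in \<open>auto intro!: derivative_eq_intros\<close>)
  have along_b: "((\<lambda>r. f' (x + s *\<^sub>R a + r *\<^sub>R b) a) has_derivative
      (\<lambda>\<delta>. g' (x + s *\<^sub>R a + r *\<^sub>R b) (\<delta> *\<^sub>R b))) (at r within {0..h})"
    if "0 \<le> s" "s \<le> h" "0 \<le> r" "r \<le> h" for s r
    by (rule has_derivative_in_compose2[where t = S and g = "\<lambda>z. f' z a" and g' = g'])
       (use that g' S in \<open>auto intro!: derivative_eq_intros\<close>)
  let ?\<phi> = "\<lambda>s. f (x + s *\<^sub>R a + h *\<^sub>R b) - f (x + s *\<^sub>R a + 0 *\<^sub>R b)"
  have "\<exists>s\<in>{0<..<h}. ?\<phi> h - ?\<phi> 0 =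
      f' (x + s *\<^sub>R a + h *\<^sub>R b) ((h - 0) *\<^sub>R a) - f' (x + s *\<^sub>R a + 0 *\<^sub>R b) ((h - 0) *\<^sub>R a)"
    by (rule mvt_simple) (use h in \<open>auto intro!: has_derivative_diff along_a\<close>, use along_a[of _ 0] in auto)
  then obtain s where s: "0 < s" "s < h" "?\<phi> h - ?\<phi> 0 =
      f' (x + s *\<^sub>R a + h *\<^sub>R b) (h *\<^sub>R a) - f' (x + s *\<^sub>R a + 0 *\<^sub>R b) (h *\<^sub>R a)"
    by auto
  have "\<exists>r\<in>{0<..<h}. f' (x + s *\<^sub>R a + h *\<^sub>R b) a - f' (x + s *\<^sub>R a + 0 *\<^sub>R b) a
      = g' (x + s *\<^sub>R a + r *\<^sub>R b) ((h - 0) *\<^sub>R b)"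
    by (rule mvt_simple) (use h s in \<open>auto intro!: along_b\<close>)
  then obtain r where r: "0 < r" "r < h" "f' (x + s *\<^sub>R a + h *\<^sub>R b) a - f' (x + s *\<^sub>R a + 0 *\<^sub>R b) a
      = g' (x + s *\<^sub>R a + r *\<^sub>R b) (h *\<^sub>R b)"
    by auto
  have lin_f': "f' y (h *\<^sub>R a) = h * f' y a" if "y \<in> S" for y
    using linear_scale[OF has_derivative_linear[OF f'[OF that]]] by simp
  have lin_g': "g' y (h *\<^sub>R b) = h * g' y b" if "y \<in> S" for y
    using linear_scale[OF has_derivative_linear[OF g'[OF that]]] by simp
  have "?\<phi> h - ?\<phi> 0 = h * (f' (x + s *\<^sub>R a + h *\<^sub>R b) a - f' (x + s *\<^sub>R a + 0 *\<^sub>R b) a)"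
    unfolding s(3) using S[of s h] S[of s 0] s(1,2) h lin_f' by (simp add: right_diff_distrib)
  also have "\<dots> = h * h * g' (x + s *\<^sub>R a + r *\<^sub>R b) b"
    unfolding r(3) using S[of s r] s(1,2) r(1,2) lin_g' by simp
  finally show ?thesis
    using that[of s r] s(1,2) r(1,2) by simp
qed

text \<open>
  Only the quadrant at \<open>x\<close> spanned by \<open>a\<close> and \<open>b\<close> has to lie in \<open>S\<close>, so that \<open>x\<close> may be a
  boundary point of \<open>S\<close>; this covers the initial time of a flow.
\<close>

lemma mixed_derivatives_symmetric_real:
  fixes f :: "'a::real_normed_vector \<Rightarrow> real"
  assumes f': "\<And>y. y \<in> S \<Longrightarrow> (f has_derivative f' y) (at y within S)"
    and g': "\<And>y. y \<in> S \<Longrightarrow> ((\<lambda>z. f' z a) has_derivative g' y) (at y within S)"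
    and k': "\<And>y. y \<in> S \<Longrightarrow> ((\<lambda>z. f' z b) has_derivative k' y) (at y within S)"
    and cont: "continuous_on S (\<lambda>y. g' y b)" "continuous_on S (\<lambda>y. k' y a)"
    and \<delta>: "0 < \<delta>"
    and S: "\<And>s r. 0 \<le> s \<Longrightarrow> s \<le> \<delta> \<Longrightarrow> 0 \<le> r \<Longrightarrow> r \<le> \<delta> \<Longrightarrow> x + s *\<^sub>R a + r *\<^sub>R b \<in> S"
  shows "g' x b = k' x a"
proof (rule ccontr)
  assume neq: "g' x b \<noteq> k' x a"
  define e where "e = \<bar>g' x b - k' x a\<bar> / 2"
  have e: "e > 0"
    using neq by (simp add: e_def)
  have x: "x \<in> S"
    using S[of 0 0] \<delta> by simp
  obtain d1 where d1: "d1 > 0" "\<And>y. y \<in> S \<Longrightarrow> dist y x < d1 \<Longrightarrow> dist (g' y b) (g' x b) < e"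
    using cont(1) x e unfolding continuous_on_iff by metis
  obtain d2 where d2: "d2 > 0" "\<And>y. y \<in> S \<Longrightarrow> dist y x < d2 \<Longrightarrow> dist (k' y a) (k' x a) < e"
    using cont(2) x e unfolding continuous_on_iff by metis
  define h where "h = min \<delta> (min d1 d2 / (norm a + norm b + 1))"
  have h: "0 < h" "h \<le> \<delta>"
    using \<delta> d1(1) d2(1) by (auto simp: h_def add_nonneg_pos)
  have "h * (norm a + norm b) < h * (norm a + norm b + 1)"
    using h by simp
  also have "\<dots> \<le> min d1 d2"
  proof -
    have "h \<le> min d1 d2 / (norm a + norm b + 1)"
      by (simp add: h_def)
    then show ?thesis
      by (subst (asm) pos_le_divide_eq) (auto simp: add_nonneg_pos)
  qed
  finally have small: "h * (norm a + norm b) < min d1 d2" .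
  have near: "dist (x + s *\<^sub>R a + r *\<^sub>R b) x < min d1 d2" if "0 < s" "s < h" "0 < r" "r < h" for s r
  proof -
    have "dist (x + s *\<^sub>R a + r *\<^sub>R b) x \<le> s * norm a + r * norm b"
      using that norm_triangle_ineq[of "s *\<^sub>R a" "r *\<^sub>R b"] by (simp add: dist_norm add.assoc)
    also have "\<dots> \<le> h * norm a + h * norm b"
      using that by (intro add_mono mult_right_mono) auto
    finally show ?thesis
      using small by (simp add: distrib_left)
  qed
  have S': "x + s *\<^sub>R a + r *\<^sub>R b \<in> S" if "0 \<le> s" "s \<le> h" "0 \<le> r" "r \<le> h" for s r
    using that h S by auto
  obtain s1 r1 where 1: "0 < s1" "s1 < h" "0 < r1" "r1 < h"
    "f (x + h *\<^sub>R a + h *\<^sub>R b) - f (x + h *\<^sub>R a) - f (x + h *\<^sub>R b) + f x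
       = h * h * g' (x + s1 *\<^sub>R a + r1 *\<^sub>R b) b"
    by (rule second_difference_eq_mixed_derivative[OF f' g' h(1) S'])
  have S'': "x + s *\<^sub>R b + r *\<^sub>R a \<in> S" if "0 \<le> s" "s \<le> h" "0 \<le> r" "r \<le> h" for s r
    using that S'[of r s] by (simp add: add_ac)
  obtain r2 s2 where 2: "0 < r2" "r2 < h" "0 < s2" "s2 < h"
    "f (x + h *\<^sub>R b + h *\<^sub>R a) - f (x + h *\<^sub>R b) - f (x + h *\<^sub>R a) + f x
       = h * h * k' (x + r2 *\<^sub>R b + s2 *\<^sub>R a) a"
    by (rule second_difference_eq_mixed_derivative[OF f' k' h(1) S''])
  have swap: "x + r *\<^sub>R b + s *\<^sub>R a = x + s *\<^sub>R a + r *\<^sub>R b" for r s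
    by (simp add: add_ac)
  have "h * h * g' (x + s1 *\<^sub>R a + r1 *\<^sub>R b) b = h * h * k' (x + s2 *\<^sub>R a + r2 *\<^sub>R b) a"
    using 1(5) 2(5) unfolding swap by linarith
  then have eq: "g' (x + s1 *\<^sub>R a + r1 *\<^sub>R b) b = k' (x + s2 *\<^sub>R a + r2 *\<^sub>R b) a"
    using h by simp
  have "dist (g' (x + s1 *\<^sub>R a + r1 *\<^sub>R b) b) (g' x b) < e"
    using 1 near[of s1 r1] S'[of s1 r1] by (intro d1) auto
  moreover have "dist (k' (x + s2 *\<^sub>R a + r2 *\<^sub>R b) a) (k' x a) < e"
    using 2 near[of s2 r2] S'[of s2 r2] by (intro d2) auto
  ultimately have "\<bar>g' x b - k' x a\<bar> < 2 * e"
    unfolding eq by (simp add: dist_real_def)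
  then show False
    by (simp add: e_def)
qed

lemma mixed_derivatives_symmetric:
  fixes f :: "'a::real_normed_vector \<Rightarrow> 'v::real_inner"
  assumes f': "\<And>y. y \<in> S \<Longrightarrow> (f has_derivative f' y) (at y within S)"
    and g': "\<And>y. y \<in> S \<Longrightarrow> ((\<lambda>z. f' z a) has_derivative g' y) (at y within S)"
    and k': "\<And>y. y \<in> S \<Longrightarrow> ((\<lambda>z. f' z b) has_derivative k' y) (at y within S)"
    and cont: "continuous_on S (\<lambda>y. g' y b)" "continuous_on S (\<lambda>y. k' y a)"
    and \<delta>: "0 < \<delta>"
    and S: "\<And>s r. 0 \<le> s \<Longrightarrow> s \<le> \<delta> \<Longrightarrow> 0 \<le> r \<Longrightarrow> r \<le> \<delta> \<Longrightarrow> x + s *\<^sub>R a + r *\<^sub>R b \<in> S"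
  shows "g' x b = k' x a"
proof -
  have "inner (g' x b) w = inner (k' x a) w" for w
    by (rule mixed_derivatives_symmetric_real[where f = "\<lambda>y. inner (f y) w" and a = a and b = b
          and f' = "\<lambda>y v. inner (f' y v) w" and g' = "\<lambda>y v. inner (g' y v) w"
          and k' = "\<lambda>y v. inner (k' y v) w", OF _ _ _ _ _ \<delta> S])
       (intro has_derivative_inner_left f' g' k' continuous_intros cont; assumption)+
  then have "inner (g' x b - k' x a) (g' x b - k' x a) = 0"
    by (simp add: inner_diff_left)
  then show ?thesis
    by simp
qed


section \<open>Families of hypersurfaces in a coordinate domain\<close>

lemma has_derivative_partials:
  fixes f :: "real \<times> 'e::real_normed_vector \<Rightarrow> 'v::real_normed_vector"
  assumes f: "\<And>p. p \<in> I \<times> S \<Longrightarrow> (f has_derivative f' p) (at p within I \<times> S)"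
    and t: "t \<in> I" and y: "y \<in> S" "open S"
  shows has_vector_derivative_time_slice:
      "((\<lambda>s. f (s, y)) has_vector_derivative f' (t, y) (1, 0)) (at t within I)"
    and has_derivative_space_slice:
      "((\<lambda>z. f (t, z)) has_derivative (\<lambda>e. f' (t, y) (0, e))) (at y)"
proof -
  have "((\<lambda>s. f (s, y)) has_derivative (\<lambda>\<delta>. f' (t, y) (\<delta>, 0))) (at t within I)"
    by (rule has_derivative_in_compose2[where t = "I \<times> S" and g' = f'])
       (use f t y in \<open>auto intro!: derivative_eq_intros\<close>)
  moreover have "(\<lambda>\<delta>. f' (t, y) (\<delta>, 0)) = (\<lambda>\<delta>. \<delta> *\<^sub>R f' (t, y) (1, 0))"
  proof
    fix \<delta>
    have "linear (f' (t, y))"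
      using f t y by (intro has_derivative_linear) auto
    from linear_scale[OF this, of \<delta> "(1, 0)"]
    show "f' (t, y) (\<delta>, 0) = \<delta> *\<^sub>R f' (t, y) (1, 0)"
      by (simp only: scaleR_Pair scaleR_zero_right real_scaleR_def mult_1_right)
  qed
  ultimately show "((\<lambda>s. f (s, y)) has_vector_derivative f' (t, y) (1, 0)) (at t within I)"
    unfolding has_vector_derivative_def by metis
  have "((\<lambda>z. f (t, z)) has_derivative (\<lambda>e. f' (t, y) (0, e))) (at y within S)"
    by (rule has_derivative_in_compose2[where t = "I \<times> S" and g' = f'])
       (use f t y in \<open>auto intro!: derivative_eq_intros\<close>)
  then show "((\<lambda>z. f (t, z)) has_derivative (\<lambda>e. f' (t, y) (0, e))) (at y)"
    by (simp only: at_within_open[OF y])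
qed

text \<open>This makes one-sided time derivatives unique.\<close>

lemma at_within_right_interval_neq_bot:
  fixes t h :: real
  assumes "0 < h" "{t..t + h} \<subseteq> I"
  shows "at t within I \<noteq> bot"
proof -
  have "at t within {t..t + h} \<noteq> bot"
    using assms(1) by (simp add: trivial_limit_within islimpt_Icc)
  then show ?thesis
    using at_le[OF assms(2), of t] by (metis bot.extremum_uniqueI)
qed

lemma Ck_on_SucE:
  assumes "Ck_on (Suc k) S f"
  obtains f' where "\<And>x. x \<in> S \<Longrightarrow> (f has_derivative f' x) (at x within S)"
    "\<And>v. Ck_on k S (\<lambda>x. f' x v)"
  using assms by auto

lemma Ck_on_1E:
  assumes "Ck_on 1 S f"
  obtains f' where "\<And>x. x \<in> S \<Longrightarrow> (f has_derivative f' x) (at x within S)"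
    "\<And>v. continuous_on S (\<lambda>x. f' x v)"
  using assms by auto

text \<open>
  The evolution of the unit normal \<open>\<nu>\<close> of a hypersurface \<open>\<Phi>\<close> moving with normal velocity \<open>\<rho>\<close>.
  Differentiating \<open>\<langle>\<nu>, D\<^sub>e \<Phi>\<rangle> = 0\<close> in time and interchanging the derivatives of \<open>\<Phi>\<close> gives
  \<open>\<langle>\<partial>\<^sub>t \<nu>, D\<^sub>e \<Phi>\<rangle> = - \<langle>\<nu>, D\<^sub>e (\<rho> \<nu>)\<rangle>\<close>, and \<open>\<langle>\<nu>, D\<^sub>e \<nu>\<rangle> = 0\<close> reduces the right-hand side
  to \<open>- D\<^sub>e \<rho>\<close>.  The differentiability of \<open>\<rho>\<close> comes from \<open>\<rho> = \<langle>\<partial>\<^sub>t \<Phi>, \<nu>\<rangle>\<close>.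
\<close>

lemma unit_normal_evolution:
  fixes \<Phi> \<nu> :: "real \<Rightarrow> 'e::real_normed_vector \<Rightarrow> 'v::real_inner"
  assumes I: "\<And>t. t \<in> I \<Longrightarrow> \<exists>h>0. {t..t + h} \<subseteq> I"
    and S: "open S"
    and \<Phi>: "Ck_on 2 (I \<times> S) (\<lambda>(t, y). \<Phi> t y)"
    and \<nu>: "Ck_on 1 (I \<times> S) (\<lambda>(t, y). \<nu> t y)"
    and unit: "\<And>t y. t \<in> I \<Longrightarrow> y \<in> S \<Longrightarrow> norm (\<nu> t y) = 1"
    and velocity: "\<And>t y. t \<in> I \<Longrightarrow> y \<in> S \<Longrightarrow>
      ((\<lambda>s. \<Phi> s y) has_vector_derivative \<rho> t y *\<^sub>R \<nu> t y) (at t within I)"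
    and t: "t \<in> I" and y: "y \<in> S"
  obtains \<nu>t where "\<Phi> t differentiable (at y)" "\<rho> t differentiable (at y)"
    "((\<lambda>s. \<nu> s y) has_vector_derivative \<nu>t) (at t within I)"
    "inner \<nu>t (\<nu> t y) = 0"
    "\<And>e. (\<And>s. s \<in> I \<Longrightarrow> inner (\<nu> s y) (frechet_derivative (\<Phi> s) (at y) e) = 0) \<Longrightarrow>
       inner \<nu>t (frechet_derivative (\<Phi> t) (at y) e) = - frechet_derivative (\<rho> t) (at y) e"
proof -
  let ?P = "I \<times> S"
  have unique: "at s within I \<noteq> bot" if "s \<in> I" for s
    using I[OF that] at_within_right_interval_neq_bot by blast
  obtain \<Phi>' where \<Phi>': "\<And>p. p \<in> ?P \<Longrightarrow> ((\<lambda>(t, y). \<Phi> t y) has_derivative \<Phi>' p) (at p within ?P)"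
    and \<Phi>'_C1: "\<And>v. Ck_on 1 ?P (\<lambda>p. \<Phi>' p v)"
    by (rule Ck_on_SucE[OF \<Phi>[unfolded numeral_2_eq_2 One_nat_def[symmetric]]]) (rule that)
  obtain \<nu>' where \<nu>': "\<And>p. p \<in> ?P \<Longrightarrow> ((\<lambda>(t, y). \<nu> t y) has_derivative \<nu>' p) (at p within ?P)"
    by (rule Ck_on_1E[OF \<nu>]) (rule that)
  obtain K where K: "\<And>p. p \<in> ?P \<Longrightarrow> ((\<lambda>p. \<Phi>' p (1, 0)) has_derivative K p) (at p within ?P)"
    and K_cont: "\<And>v. continuous_on ?P (\<lambda>p. K p v)"
    by (rule Ck_on_1E[OF \<Phi>'_C1[of "(1, 0)"]]) (rule that)
  have \<Phi>_space: "(\<Phi> s has_derivative (\<lambda>e. \<Phi>' (s, y) (0, e))) (at y)" if "s \<in> I" for s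
    using has_derivative_space_slice[OF \<Phi>' that y S] by simp
  have D\<Phi>: "frechet_derivative (\<Phi> s) (at y) e = \<Phi>' (s, y) (0, e)" if "s \<in> I" for s e
    using frechet_derivative_at[OF \<Phi>_space[OF that]] by metis
  have \<nu>_time: "((\<lambda>s. \<nu> s y) has_vector_derivative \<nu>' (t, y) (1, 0)) (at t within I)"
    using has_vector_derivative_time_slice[OF \<nu>' t y S] by simp
  have \<nu>_space: "(\<nu> t has_derivative (\<lambda>e. \<nu>' (t, y) (0, e))) (at y)"
    using has_derivative_space_slice[OF \<nu>' t y S] by simp
  have \<nu>\<nu>: "inner (\<nu> s z) (\<nu> s z) = 1" if "s \<in> I" "z \<in> S" for s z
    using unit[OF that] by (simp add: dot_square_norm)
  have \<nu>t_orth: "inner (\<nu>' (t, y) (1, 0)) (\<nu> t y) = 0"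
  proof -
    have "((\<lambda>s. inner (\<nu> s y) (\<nu> s y)) has_vector_derivative
        inner (\<nu> t y) (\<nu>' (t, y) (1, 0)) + inner (\<nu>' (t, y) (1, 0)) (\<nu> t y)) (at t within I)"
      by (intro bounded_bilinear.has_vector_derivative[OF bounded_bilinear_inner] \<nu>_time)
    moreover have "((\<lambda>s. inner (\<nu> s y) (\<nu> s y)) has_vector_derivative 0) (at t within I)"
      by (rule has_vector_derivative_transform[OF t, where f = "\<lambda>_. 1"])
         (use \<nu>\<nu> y in auto)
    ultimately have "inner (\<nu> t y) (\<nu>' (t, y) (1, 0)) + inner (\<nu>' (t, y) (1, 0)) (\<nu> t y) = 0"
      by (rule vector_derivative_unique_within[OF unique[OF t]])
    then show ?thesis
      by (simp add: inner_commute)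
  qed
  have \<nu>e_orth: "inner (\<nu>' (t, y) (0, e)) (\<nu> t y) = 0" for e
  proof -
    have "((\<lambda>z. inner (\<nu> t z) (\<nu> t z)) has_derivative
        (\<lambda>e. inner (\<nu> t y) (\<nu>' (t, y) (0, e)) + inner (\<nu>' (t, y) (0, e)) (\<nu> t y))) (at y)"
      by (intro has_derivative_inner \<nu>_space)
    moreover have "((\<lambda>z. inner (\<nu> t z) (\<nu> t z)) has_derivative (\<lambda>_. 0)) (at y)"
      by (rule has_derivative_transform_within_open[OF has_derivative_const S y, of 1])
         (use \<nu>\<nu> t in auto)
    ultimately have "(\<lambda>e. inner (\<nu> t y) (\<nu>' (t, y) (0, e)) + inner (\<nu>' (t, y) (0, e)) (\<nu> t y))
        = (\<lambda>_. 0)"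
      by (rule has_derivative_unique)
    from fun_cong[OF this, of e] show ?thesis
      by (simp add: inner_commute)
  qed
  have \<Phi>_time: "\<Phi>' (s, z) (1, 0) = \<rho> s z *\<^sub>R \<nu> s z" if "s \<in> I" "z \<in> S" for s z
    using vector_derivative_unique_within[OF unique[OF that(1)] _ velocity[OF that]]
      has_vector_derivative_time_slice[OF \<Phi>' that S] by simp
  have \<rho>_space: "(\<rho> t has_derivative (\<lambda>e. inner (K (t, y) (0, e)) (\<nu> t y))) (at y)"
  proof -
    have "((\<lambda>z. inner (\<Phi>' (t, z) (1, 0)) (\<nu> t z)) has_derivative
        (\<lambda>e. inner (\<Phi>' (t, y) (1, 0)) (\<nu>' (t, y) (0, e)) + inner (K (t, y) (0, e)) (\<nu> t y))) (at y)"
      by (intro has_derivative_inner \<nu>_space has_derivative_space_slice[OF K t y S])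
    moreover have "inner (\<Phi>' (t, y) (1, 0)) (\<nu>' (t, y) (0, e)) = 0" for e
      using \<nu>e_orth[of e] by (simp add: \<Phi>_time[OF t y] inner_commute)
    ultimately have "((\<lambda>z. inner (\<Phi>' (t, z) (1, 0)) (\<nu> t z)) has_derivative
        (\<lambda>e. inner (K (t, y) (0, e)) (\<nu> t y))) (at y)"
      by simp
    then show ?thesis
      by (rule has_derivative_transform_within_open[OF _ S y]) (use \<Phi>_time[OF t] \<nu>\<nu>[OF t] in simp)
  qed
  have evolution: "inner (\<nu>' (t, y) (1, 0)) (frechet_derivative (\<Phi> t) (at y) e)
      = - frechet_derivative (\<rho> t) (at y) e"
    if normal: "\<And>s. s \<in> I \<Longrightarrow> inner (\<nu> s y) (frechet_derivative (\<Phi> s) (at y) e) = 0" for e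
  proof -
    obtain L where L: "\<And>p. p \<in> ?P \<Longrightarrow> ((\<lambda>p. \<Phi>' p (0, e)) has_derivative L p) (at p within ?P)"
      and L_cont: "\<And>v. continuous_on ?P (\<lambda>p. L p v)"
      by (rule Ck_on_1E[OF \<Phi>'_C1[of "(0, e)"]]) (rule that)
    have sym: "K (t, y) (0, e) = L (t, y) (1, 0)"
    proof -
      obtain h where h: "0 < h" "{t..t + h} \<subseteq> I"
        using I[OF t] by blast
      obtain r where r: "0 < r" "ball y r \<subseteq> S"
        using S y by (auto simp: open_contains_ball)
      \<comment> \<open>the side of a corner at \<open>(t, y)\<close>, forwards in time, that stays in \<open>I \<times> S\<close>\<close>
      define \<delta> where "\<delta> = min h (r / (norm e + 1))"
      have \<delta>: "0 < \<delta>" "\<delta> \<le> h" "\<delta> \<le> r / (norm e + 1)"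
        using h r by (auto simp: \<delta>_def add_nonneg_pos)
      have corner: "(t, y) + a *\<^sub>R (1, 0) + b *\<^sub>R (0, e) \<in> ?P"
        if ab: "0 \<le> a" "a \<le> \<delta>" "0 \<le> b" "b \<le> \<delta>" for a b
      proof -
        have "b * norm e \<le> \<delta> * norm e"
          using ab by (intro mult_right_mono) auto
        also have "\<dots> < \<delta> * (norm e + 1)"
          using \<delta> by simp
        also have "\<dots> \<le> r"
          using \<delta>(3) by (subst (asm) pos_le_divide_eq) (auto simp: add_nonneg_pos)
        finally have "y + b *\<^sub>R e \<in> S"
          using ab r by (auto simp: dist_norm intro!: subsetD[OF r(2)])
        moreover have "t + a \<in> I"
          using ab \<delta> h by auto
        ultimately show ?thesis
          by simp
      qed
      show ?thesis
        by (rule mixed_derivatives_symmetric[OF \<Phi>' K L K_cont L_cont \<delta>(1) corner])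
    qed
    have "((\<lambda>s. inner (\<nu> s y) (\<Phi>' (s, y) (0, e))) has_vector_derivative
        inner (\<nu> t y) (L (t, y) (1, 0)) + inner (\<nu>' (t, y) (1, 0)) (\<Phi>' (t, y) (0, e))) (at t within I)"
      by (intro bounded_bilinear.has_vector_derivative[OF bounded_bilinear_inner] \<nu>_time
            has_vector_derivative_time_slice[OF L t y S])
    moreover have "((\<lambda>s. inner (\<nu> s y) (\<Phi>' (s, y) (0, e))) has_vector_derivative 0) (at t within I)"
      by (rule has_vector_derivative_transform[OF t, where f = "\<lambda>_. 0"])
         (use normal D\<Phi> in auto)
    ultimately have "inner (\<nu> t y) (L (t, y) (1, 0)) + inner (\<nu>' (t, y) (1, 0)) (\<Phi>' (t, y) (0, e)) = 0"
      by (rule vector_derivative_unique_within[OF unique[OF t]])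
    moreover have "frechet_derivative (\<rho> t) (at y) e = inner (K (t, y) (0, e)) (\<nu> t y)"
      using frechet_derivative_at[OF \<rho>_space] by metis
    ultimately show ?thesis
      by (simp add: D\<Phi>[OF t] sym inner_commute)
  qed
  show ?thesis
    by (rule that[OF differentiableI[OF \<Phi>_space[OF t]] differentiableI[OF \<rho>_space] \<nu>_time \<nu>t_orth evolution])
qed


section \<open>Tangent spaces and gradients\<close>

lemma hilbert_manifold_charts:
  assumes "hilbert_manifold A" "c \<in> charts_at A u"
  shows "c \<in> A" "u \<in> fst c" "open (snd c ` fst c)" "snd c u \<in> snd c ` fst c" "cinv c (snd c u) = u"
  using assms unfolding charts_at_def hilbert_manifold_def homeomorphism_def by auto

lemma hilbert_manifold_chart_exists:
  assumes "hilbert_manifold A"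
  shows "(SOME c. c \<in> charts_at A u) \<in> charts_at A u"
proof -
  have "u \<in> (\<Union>c\<in>A. fst c)"
    using assms by (simp add: hilbert_manifold_def)
  then have "\<exists>c. c \<in> charts_at A u"
    by (auto simp: charts_at_def)
  then show ?thesis
    by (rule someI_ex)
qed

lemma coordinate_change_differentiable:
  assumes M: "hilbert_manifold A" and c: "c \<in> charts_at A u" and d: "d \<in> charts_at A u"
  shows "(snd d \<circ> cinv c) differentiable (at (snd c u))"
proof -
  let ?S = "snd c ` (fst c \<inter> fst d)"
  have cA: "c \<in> A" and dA: "d \<in> A"
    using c d by (auto simp: charts_at_def)
  have open_c: "open (fst c)" "open (fst d)" "open (snd c ` fst c)"
    and hom: "homeomorphism (fst c) (snd c ` fst c) (snd c) (cinv c)"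
    using M cA dA by (auto simp: hilbert_manifold_def)
  have "openin (top_of_set (fst c)) (fst c \<inter> fst d)"
    using open_c by (intro openin_open_Int)
  then have "openin (top_of_set (snd c ` fst c)) ?S"
    using homeomorphism_imp_open_map[OF hom] by blast
  then have S: "open ?S"
    using open_c(3) openin_open_eq by blast
  have "Ck_on (Suc 0) ?S (snd d \<circ> cinv c)"
    using M cA dA by (auto simp: hilbert_manifold_def smooth_on_def simp del: Ck_on.simps)
  then obtain f' where "\<And>x. x \<in> ?S \<Longrightarrow> ((snd d \<circ> cinv c) has_derivative f' x) (at x within ?S)"
    by (rule Ck_on_SucE) (rule that)
  moreover have "snd c u \<in> ?S"
    using c d by (auto simp: charts_at_def)
  ultimately show ?thesis
    using S by (metis at_within_open differentiableI)
qed

lemma tangent_spaceI: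
  assumes "\<And>c. c \<notin> charts_at A u \<Longrightarrow> X c = 0"
    and "\<And>c d. c \<in> charts_at A u \<Longrightarrow> d \<in> charts_at A u \<Longrightarrow>
      X d = frechet_derivative (snd d \<circ> cinv c) (at (snd c u)) (X c)"
  shows "X \<in> tangent_space A u"
  unfolding tangent_space_def using assms by blast

lemma tangent_space_outside: "X \<in> tangent_space A u \<Longrightarrow> c \<notin> charts_at A u \<Longrightarrow> X c = 0"
  unfolding tangent_space_def by blast

lemma tangent_space_change:
  "X \<in> tangent_space A u \<Longrightarrow> c \<in> charts_at A u \<Longrightarrow> d \<in> charts_at A u \<Longrightarrow>
     X d = frechet_derivative (snd d \<circ> cinv c) (at (snd c u)) (X c)"
  unfolding tangent_space_def by blast

lemma subspace_tangent_image:
  assumes M: "hilbert_manifold A"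
    and f: "\<And>c. c \<in> charts_at A u \<Longrightarrow> (f \<circ> cinv c) differentiable (at (snd c u))"
  shows "subspace (tangent_image A f u)"
proof -
  let ?c = "SOME c. c \<in> charts_at A u"
  have lin: "linear (frechet_derivative (f \<circ> cinv ?c) (at (snd ?c u)))"
    using f hilbert_manifold_chart_exists[OF M] by (intro linear_frechet_derivative) auto
  have lin_change: "linear (frechet_derivative (snd d \<circ> cinv c) (at (snd c u)))"
    if "c \<in> charts_at A u" "d \<in> charts_at A u" for c d
    using coordinate_change_differentiable[OF M that] by (rule linear_frechet_derivative)
  have add: "(\<lambda>c. X c + Y c) \<in> tangent_space A u"
    if X: "X \<in> tangent_space A u" and Y: "Y \<in> tangent_space A u" for X Y
  proof (rule tangent_spaceI)
    fix c d
    assume cd: "c \<in> charts_at A u" "d \<in> charts_at A u"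
    show "X d + Y d = frechet_derivative (snd d \<circ> cinv c) (at (snd c u)) (X c + Y c)"
      unfolding linear_add[OF lin_change[OF cd]]
      by (rule arg_cong2[where f = "(+)", OF tangent_space_change[OF X cd] tangent_space_change[OF Y cd]])
  qed (simp add: tangent_space_outside[OF X] tangent_space_outside[OF Y])
  have scale: "(\<lambda>c. k *\<^sub>R X c) \<in> tangent_space A u" if X: "X \<in> tangent_space A u" for k X
  proof (rule tangent_spaceI)
    fix c d
    assume cd: "c \<in> charts_at A u" "d \<in> charts_at A u"
    show "k *\<^sub>R X d = frechet_derivative (snd d \<circ> cinv c) (at (snd c u)) (k *\<^sub>R X c)"
      unfolding linear_scale[OF lin_change[OF cd]]
      by (rule arg_cong[where f = "scaleR k", OF tangent_space_change[OF X cd]])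
  qed (simp add: tangent_space_outside[OF X])
  have zero: "(\<lambda>_. 0) \<in> tangent_space A u"
    by (rule tangent_spaceI) (simp_all add: linear_0[OF lin_change])
  show ?thesis
    unfolding subspace_def tangent_image_def
  proof (intro conjI ballI allI)
    show "0 \<in> pushforward A f u ` tangent_space A u"
      by (rule image_eqI[OF _ zero]) (simp add: pushforward_def Let_def linear_0[OF lin])
  next
    fix x y
    assume "x \<in> pushforward A f u ` tangent_space A u" "y \<in> pushforward A f u ` tangent_space A u"
    then obtain X Y where XY: "X \<in> tangent_space A u" "Y \<in> tangent_space A u"
      and "x = pushforward A f u X" "y = pushforward A f u Y"
      by blast
    then have "x + y = pushforward A f u (\<lambda>c. X c + Y c)"
      by (simp add: pushforward_def Let_def linear_add[OF lin])
    then show "x + y \<in> pushforward A f u ` tangent_space A u"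
      using add[OF XY] by (rule image_eqI)
  next
    fix k x
    assume "x \<in> pushforward A f u ` tangent_space A u"
    then obtain X where X: "X \<in> tangent_space A u" and "x = pushforward A f u X"
      by blast
    then have "k *\<^sub>R x = pushforward A f u (\<lambda>c. k *\<^sub>R X c)"
      by (simp add: pushforward_def Let_def linear_scale[OF lin])
    then show "k *\<^sub>R x \<in> pushforward A f u ` tangent_space A u"
      using scale[OF X] by (rule image_eqI)
  qed
qed

text \<open>
  In codimension one, orthogonality to a single normal vector is orthogonality to the whole
  normal space, and the tangent space is recovered as the complement of the normal space.
\<close>

lemma tangent_of_hypersurfaceI:
  fixes f :: "'m::topological_space \<Rightarrow> 'v::{real_inner,complete_space}"
  assumes im: "closed (tangent_image A f u)" "subspace (tangent_image A f u)"
    and codim: "dim (normal_subspace A f u) = 1"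
    and n: "n \<in> normal_subspace A f u" "n \<noteq> 0"
    and w: "inner w n = 0"
  shows "w \<in> tangent_image A f u"
proof (rule closed_subspace_double_complement[OF im])
  fix v
  assume "\<forall>s\<in>tangent_image A f u. inner v s = 0"
  then have "v \<in> normal_subspace A f u"
    by (simp add: normal_subspace_def)
  then obtain k where "v = k *\<^sub>R n"
    using dim_1_scaleR_of_nonzero[OF codim n] by blast
  then show "inner w v = 0"
    using w by simp
qed

text \<open>The induced metric of an immersion is nondegenerate, so gradients are unique.\<close>

lemma gradient_eqI:
  assumes f: "immersion A f"
    and Y: "is_gradient A (induced_metric A f u) h u Y"
  shows "gradient A (induced_metric A f u) h u = Y"
  unfolding gradient_def
proof (rule the_equality)
  fix Z
  assume Z: "is_gradient A (induced_metric A f u) h u Z"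
  let ?p = "pushforward A f u"
  have mem: "Y \<in> tangent_space A u" "Z \<in> tangent_space A u"
    using Y Z by (auto simp: is_gradient_def)
  have eq: "inner (?p Z) (?p X) = inner (?p Y) (?p X)" if "X \<in> tangent_space A u" for X
    using Y Z that by (auto simp: is_gradient_def induced_metric_def)
  have "inner (?p Z - ?p Y) (?p Z - ?p Y) = 0"
    using eq[OF mem(1)] eq[OF mem(2)] by (simp add: inner_diff)
  then have "?p Z = ?p Y"
    by simp
  then show "Z = Y"
    using f mem by (auto simp: immersion_def inj_on_def)
qed (fact Y)

lemma time_interval_right_neighbourhood:
  assumes "t \<in> time_interval T"
  shows "\<exists>h>0. {t..t + h} \<subseteq> time_interval T"
proof -
  have "ereal t < T"
    using assms by (simp add: time_interval_def)
  then obtain s where s: "t < s" "ereal s < T"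
    using ereal_dense2[of "ereal t" T] by auto
  then have "{t..t + (s - t)} \<subseteq> time_interval T"
    using assms by (auto simp: time_interval_def intro: le_less_trans[of _ "ereal s"])
  then show ?thesis
    using s(1) by (intro exI[of _ "s - t"]) auto
qed


section \<open>Evolution of the unit normal along the flow\<close>

theorem lemma4p3:
  fixes AG :: "('g::t2_space, 'h::{real_inner,complete_space}) chart set"
    and G :: "'g monoid"
    and act :: "'g \<Rightarrow> 'v::{real_inner,polish_space} \<Rightarrow> 'v"
    and C :: "('b::euclidean_space, 'v set) ochart set"
    and A :: "('m::t2_space, 'e::{real_inner,complete_space}) chart set"
    and actM :: "'g \<Rightarrow> 'm \<Rightarrow> 'm"
    and f :: "'m \<Rightarrow> 'v"
    and T :: ereal
    and F H \<xi> :: "real \<Rightarrow> 'm \<Rightarrow> 'v"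
  assumes V_infinite_dimensional: "\<nexists>B::'v set. finite B \<and> span B = UNIV"
    and G: "hilbert_lie_group AG G"
    and act: "smooth_action AG G vec_atlas act" "isometric_action act" "almost_free G act"
    and orbits: "\<And>x. minimal_regularizable AG (orbit_immersion act x)"
    and orbifold: "riemannian_orbifold (orbit_topology G act) C"
    and submersion: "riemannian_orbisubmersion AG G act C"
    and M: "hilbert_manifold A"
    and f: "immersion A f" "\<And>u. dim (normal_subspace A f u) = 1"
    and f_invariant: "smooth_action AG G A actM" "\<And>a u. f (actM a u) = act a (f u)"
    and f_compact: "compactin (orbit_topology G act) (range (orbit G act \<circ> f))"
    and T: "0 < T"
    and flow: "F 0 = f" "regularized_mcf A T F H" "horizontal_lift_flow AG G act C A T F"
    and hypersurfaces: "\<And>t u. t \<in> time_interval T \<Longrightarrow> dim (normal_subspace A (F t) u) = 1"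
    and \<xi>_smooth: "smooth_family (time_interval T) A \<xi>"
    and \<xi>_unit_normal: "\<And>t u. t \<in> time_interval T \<Longrightarrow> \<xi> t u \<in> normal_subspace A (F t) u \<and> norm (\<xi> t u) = 1"
    and H_\<xi>: "\<And>t u. t \<in> time_interval T \<Longrightarrow> H t u = norm (H t u) *\<^sub>R \<xi> t u"
  shows "\<forall>t\<in>time_interval T. \<forall>u.
           is_gradient A (induced_metric A (F t) u) (\<lambda>p. norm (H t p)) u
             (gradient A (induced_metric A (F t) u) (\<lambda>p. norm (H t p)) u)
         \<and> ((\<lambda>s. \<xi> s u) has_vector_derivative
              - pushforward A (F t) u (gradient A (induced_metric A (F t) u) (\<lambda>p. norm (H t p)) u))
             (at t within time_interval T)"
proof (intro ballI allI)
  fix t u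
  assume t: "t \<in> time_interval T"
  let ?I = "time_interval T"
  define \<rho> where "\<rho> t p = norm (H t p)" for t p
  have F_smooth: "smooth_family ?I A F"
    and imm: "\<And>s. s \<in> ?I \<Longrightarrow> immersion A (F s)"
    and F_velocity: "\<And>s p. s \<in> ?I \<Longrightarrow> ((\<lambda>s. F s p) has_vector_derivative H s p) (at s within ?I)"
    using flow(2) by (auto simp: regularized_mcf_def regularizable_def)
  have chart: "\<exists>\<nu>t. (F t \<circ> cinv c) differentiable (at (snd c u))
      \<and> (\<rho> t \<circ> cinv c) differentiable (at (snd c u))
      \<and> ((\<lambda>s. \<xi> s u) has_vector_derivative \<nu>t) (at t within ?I) \<and> inner \<nu>t (\<xi> t u) = 0
      \<and> (\<forall>e. (\<forall>s\<in>?I. inner (\<xi> s u) (frechet_derivative (F s \<circ> cinv c) (at (snd c u)) e) = 0) \<longrightarrow>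
           inner \<nu>t (frechet_derivative (F t \<circ> cinv c) (at (snd c u)) e)
             = - frechet_derivative (\<rho> t \<circ> cinv c) (at (snd c u)) e)"
    if c: "c \<in> charts_at A u" for c
  proof -
    note c' = hilbert_manifold_charts[OF M c]
    have velocity: "((\<lambda>s. (F s \<circ> cinv c) y) has_vector_derivative
        (\<rho> s \<circ> cinv c) y *\<^sub>R (\<xi> s \<circ> cinv c) y) (at s within ?I)" if "s \<in> ?I" for s y
      using F_velocity[OF that, of "cinv c y"] H_\<xi>[OF that, of "cinv c y"] by (simp add: \<rho>_def)
    have F2: "Ck_on 2 (?I \<times> snd c ` fst c) (\<lambda>(t, y). (F t \<circ> cinv c) y)"
      and \<xi>1: "Ck_on 1 (?I \<times> snd c ` fst c) (\<lambda>(t, y). (\<xi> t \<circ> cinv c) y)"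
      using F_smooth \<xi>_smooth c'(1) unfolding smooth_family_def smooth_on_def comp_def by blast+
    obtain \<nu>t where "(F t \<circ> cinv c) differentiable (at (snd c u))"
      "(\<rho> t \<circ> cinv c) differentiable (at (snd c u))"
      "((\<lambda>s. (\<xi> s \<circ> cinv c) (snd c u)) has_vector_derivative \<nu>t) (at t within ?I)"
      "inner \<nu>t ((\<xi> t \<circ> cinv c) (snd c u)) = 0"
      "\<And>e. (\<And>s. s \<in> ?I \<Longrightarrow> inner ((\<xi> s \<circ> cinv c) (snd c u))
              (frechet_derivative (F s \<circ> cinv c) (at (snd c u)) e) = 0) \<Longrightarrow>
         inner \<nu>t (frechet_derivative (F t \<circ> cinv c) (at (snd c u)) e)
           = - frechet_derivative (\<rho> t \<circ> cinv c) (at (snd c u)) e"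
      using unit_normal_evolution[where \<Phi> = "\<lambda>s. F s \<circ> cinv c" and \<nu> = "\<lambda>s. \<xi> s \<circ> cinv c"
          and \<rho> = "\<lambda>s. \<rho> s \<circ> cinv c", OF time_interval_right_neighbourhood c'(3) F2 \<xi>1 _ velocity t c'(4)]
        \<xi>_unit_normal by auto
    then show ?thesis
      by (auto simp: c'(5))
  qed
  \<comment> \<open>the chart in which differentials at \<open>u\<close> are evaluated, the same at all times\<close>
  let ?c = "SOME c. c \<in> charts_at A u"
  have c: "?c \<in> charts_at A u"
    by (rule hilbert_manifold_chart_exists[OF M])
  obtain \<nu>t where \<nu>t: "((\<lambda>s. \<xi> s u) has_vector_derivative \<nu>t) (at t within ?I)" "inner \<nu>t (\<xi> t u) = 0"
    and evolution: "\<And>e. (\<forall>s\<in>?I. inner (\<xi> s u) (frechet_derivative (F s \<circ> cinv ?c) (at (snd ?c u)) e) = 0) \<Longrightarrow>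
        inner \<nu>t (frechet_derivative (F t \<circ> cinv ?c) (at (snd ?c u)) e)
          = - frechet_derivative (\<rho> t \<circ> cinv ?c) (at (snd ?c u)) e"
    using chart[OF c] by blast
  have d\<rho>: "pushforward A (\<rho> t) u X = - inner \<nu>t (pushforward A (F t) u X)"
    if X: "X \<in> tangent_space A u" for X
  proof -
    have "inner (\<xi> s u) (pushforward A (F s) u X) = 0" if "s \<in> ?I" for s
      using \<xi>_unit_normal[OF that, of u] X by (auto simp: normal_subspace_def tangent_image_def)
    then show ?thesis
      using evolution[of "X ?c"] by (simp add: pushforward_def Let_def)
  qed
  have sub: "subspace (tangent_image A (F t) u)"
    using chart by (intro subspace_tangent_image[OF M]) blast
  have "- \<nu>t \<in> tangent_image A (F t) u"
  proof (rule tangent_of_hypersurfaceI[OF _ sub hypersurfaces[OF t]])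
    show "closed (tangent_image A (F t) u)"
      using imm[OF t] by (simp add: immersion_def)
    show "\<xi> t u \<in> normal_subspace A (F t) u" "\<xi> t u \<noteq> 0" "inner (- \<nu>t) (\<xi> t u) = 0"
      using \<xi>_unit_normal[OF t, of u] \<nu>t(2) by auto
  qed
  then obtain Y where Y: "Y \<in> tangent_space A u" "pushforward A (F t) u Y = - \<nu>t"
    by (auto simp: tangent_image_def)
  have "(\<rho> t \<circ> cinv c) differentiable (at (snd c u))" if "c \<in> charts_at A u" for c
    using chart[OF that] by blast
  then have grad: "is_gradient A (induced_metric A (F t) u) (\<rho> t) u Y"
    using Y d\<rho> by (simp add: is_gradient_def induced_metric_def)
  have "gradient A (induced_metric A (F t) u) (\<rho> t) u = Y"
    by (rule gradient_eqI[OF imm[OF t] grad])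
  moreover have "\<rho> t = (\<lambda>p. norm (H t p))"
    by (simp add: \<rho>_def fun_eq_iff)
  ultimately show "is_gradient A (induced_metric A (F t) u) (\<lambda>p. norm (H t p)) u
             (gradient A (induced_metric A (F t) u) (\<lambda>p. norm (H t p)) u)
         \<and> ((\<lambda>s. \<xi> s u) has_vector_derivative
              - pushforward A (F t) u (gradient A (induced_metric A (F t) u) (\<lambda>p. norm (H t p)) u))
             (at t within time_interval T)"
    using grad \<nu>t(1) Y(2) by simp
qed

end
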